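(* Let $V$ be a separable infinite-dimensional right quaternionic Hilbert space and let $T\in\mathcal{B}(V)$. Let $P_1\in\mathcal{B}(V)$ be a projector (i.e. $P_1^2=P_1$) commuting with $T$ and let $P_2=\mathbb{I}_V-P_1$. Put $T_j:=TP_j=P_jT$ for $j=1,2$. Then $$\sigma_e^S(T)=\sigma_e^S\big(T_1|_{R(P_1)}\big)\cup\sigma_e^S\big(T_2|_{R(P_2)}\big),$$ where $R(P_j)$ is the range of $P_j$ and $T_j|_{R(P_j)}$ is the restriction of $T_j$ to $R(P_j)$, regarded as an operator on $R(P_j)$.
   Context: $\mathbb{H}$ is the skew field of quaternions. A right quaternionic Hilbert space $V$ is a right $\mathbb{H}$-vector space with an $\mathbb{H}$-valued inner product satisfying $\langle f,gq+h\rangle=\langle f,g\rangle q+\langle f,h\rangle$, $\langle f,g\rangle=\overline{\langle g,f\rangle}$, $\langle f,f\rangle\ge 0$ with equality only for $f=0$, and complete for $\|f\|=\sqrt{\langle f,f\rangle}$. For a right quaternionic Hilbert space $W$ (possibly finite-dimensional), $\mathcal{B}(W)$ is the set of bounded right $\mathbb{H}$-linear operators on $W$, $\mathcal{K}(W)$ the closed two-sided ideal of compact ones, and $\mathbb{I}_W$ the identity. For $B\in\mathcal{B}(W)$ and $q\in\mathbb{H}$, $Q_q(B):=B^2-2\operatorname{Re}(q)B+|q|^2\mathbb{I}_W$. The essential $S$-spectrum $\sigma_e^S(B)$ is the $S$-spectrum of the class of $B$ in the Calkin algebra $\mathcal{B}(W)/\mathcal{K}(W)$, i.e. the set of $q\in\mathbb{H}$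 for which there is no $S\in\mathcal{B}(W)$ such that $SQ_q(B)-\mathbb{I}_W$ and $Q_q(B)S-\mathbb{I}_W$ are both compact. In particular it is empty when $W$ is finite-dimensional. *)

theory Defs
  imports "HOL-Analysis.Analysis"
begin

datatype quat = Quat (qRe: real) (qIm1: real) (qIm2: real) (qIm3: real)

lemma quat_eqI:
  "qRe p = qRe q \<Longrightarrow> qIm1 p = qIm1 q \<Longrightarrow> qIm2 p = qIm2 q \<Longrightarrow> qIm3 p = qIm3 q \<Longrightarrow> p = q"
  by (cases p; cases q) simp

lemma quat_eq_iff:
  "p = q \<longleftrightarrow> qRe p = qRe q \<and> qIm1 p = qIm1 q \<and> qIm2 p = qIm2 q \<and> qIm3 p = qIm3 q"
  by (auto intro: quat_eqI)

instantiation quat :: scaleR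
begin
definition "r *\<^sub>R q = Quat (r * qRe q) (r * qIm1 q) (r * qIm2 q) (r * qIm3 q)"
instance ..
end

instantiation quat :: real_normed_div_algebra
begin

definition "0 = Quat 0 0 0 0"
definition "1 = Quat 1 0 0 0"
definition "- p = Quat (- qRe p) (- qIm1 p) (- qIm2 p) (- qIm3 p)"
definition "p + q = Quat (qRe p + qRe q) (qIm1 p + qIm1 q) (qIm2 p + qIm2 q) (qIm3 p + qIm3 q)"
definition "p - q = Quat (qRe p - qRe q) (qIm1 p - qIm1 q) (qIm2 p - qIm2 q) (qIm3 p - qIm3 q)"
definition "p * q = Quat
  (qRe p * qRe q - qIm1 p * qIm1 q - qIm2 p * qIm2 q - qIm3 p * qIm3 q)
  (qRe p * qIm1 q + qIm1 p * qRe q + qIm2 p * qIm3 q - qIm3 p * qIm2 q)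
  (qRe p * qIm2 q - qIm1 p * qIm3 q + qIm2 p * qRe q + qIm3 p * qIm1 q)
  (qRe p * qIm3 q + qIm1 p * qIm2 q - qIm2 p * qIm1 q + qIm3 p * qRe q)"
definition "norm q = sqrt ((qRe q)\<^sup>2 + (qIm1 q)\<^sup>2 + (qIm2 q)\<^sup>2 + (qIm3 q)\<^sup>2)"
definition "sgn q = q /\<^sub>R norm q" for q :: quat
definition "dist p q = norm (p - q)" for p q :: quat
definition "(uniformity :: (quat \<times> quat) filter) = (INF e\<in>{0<..}. principal {(x, y). dist x y < e})"
definition "open U \<longleftrightarrow> (\<forall>x\<in>U. eventually (\<lambda>(x', y). x' = x \<longrightarrow> y \<in> U) uniformity)"
  for U :: "quat set"
definition "inverse q =
  (let n = (qRe q)\<^sup>2 + (qIm1 q)\<^sup>2 + (qIm2 q)\<^sup>2 + (qIm3 q)\<^sup>2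
   in Quat (qRe q / n) (- qIm1 q / n) (- qIm2 q / n) (- qIm3 q / n))"
definition "p div q = p * inverse q" for p q :: quat

instance
proof
  fix p q r :: quat and a b :: real and U :: "quat set"
  show "p + q + r = p + (q + r)" "p + q = q + p" "0 + p = p" "- p + p = 0" "p - q = p + - q"
    by (simp_all add: quat_eq_iff plus_quat_def zero_quat_def uminus_quat_def minus_quat_def)
  show "p * q * r = p * (q * r)" "(p + q) * r = p * r + q * r" "p * (q + r) = p * q + p * r"
    by (simp_all add: quat_eq_iff plus_quat_def times_quat_def algebra_simps)
  show "1 * p = p" "p * 1 = p" "(0::quat) \<noteq> 1"
    by (simp_all add: quat_eq_iff times_quat_def one_quat_def zero_quat_def)
  show "a *\<^sub>R (p + q) = a *\<^sub>R p + a *\<^sub>R q" "(a + b) *\<^sub>R p = a *\<^sub>R p + b *\<^sub>R p"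
    "a *\<^sub>R b *\<^sub>R p = (a * b) *\<^sub>R p" "1 *\<^sub>R p = p"
    "a *\<^sub>R p * q = a *\<^sub>R (p * q)" "p * a *\<^sub>R q = a *\<^sub>R (p * q)"
    by (simp_all add: quat_eq_iff plus_quat_def times_quat_def scaleR_quat_def algebra_simps)
  show "p div q = p * inverse q" by (rule divide_quat_def)
  show "inverse (0::quat) = 0"
    by (simp add: inverse_quat_def zero_quat_def)
  show inv: "inverse p * p = 1" "p * inverse p = 1" if "p \<noteq> 0"
  proof -
    define n where "n = (qRe p)\<^sup>2 + (qIm1 p)\<^sup>2 + (qIm2 p)\<^sup>2 + (qIm3 p)\<^sup>2"
    have "n \<noteq> 0"
      using that by (auto simp: n_def quat_eq_iff zero_quat_def add_nonneg_eq_0_iff)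
    moreover have "inverse p = Quat (qRe p / n) (- qIm1 p / n) (- qIm2 p / n) (- qIm3 p / n)"
      by (simp add: inverse_quat_def n_def Let_def)
    ultimately show "inverse p * p = 1" "p * inverse p = 1"
      by (simp_all add: quat_eq_iff times_quat_def one_quat_def mult.commute
          flip: add_divide_distrib diff_divide_distrib)
        (simp_all add: n_def power2_eq_square)
  qed
  show "sgn p = p /\<^sub>R norm p" by (rule sgn_quat_def)
  show "dist p q = norm (p - q)" by (rule dist_quat_def)
  show "(uniformity :: (quat \<times> quat) filter) = (INF e\<in>{0<..}. principal {(x, y). dist x y < e})"
    by (rule uniformity_quat_def)
  show "open U \<longleftrightarrow> (\<forall>x\<in>U. \<forall>\<^sub>F (x', y) in uniformity. x' = x \<longrightarrow> y \<in> U)"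
    by (rule open_quat_def)
  have norm_eq: "norm q = norm (qRe q, qIm1 q, qIm2 q, qIm3 q)" for q
    by (simp add: norm_quat_def norm_Pair algebra_simps)
  show "norm p = 0 \<longleftrightarrow> p = 0"
    by (simp add: norm_eq quat_eq_iff zero_quat_def prod_eq_iff)
  show "norm (p + q) \<le> norm p + norm q"
    using norm_triangle_ineq[of "(qRe p, qIm1 p, qIm2 p, qIm3 p)" "(qRe q, qIm1 q, qIm2 q, qIm3 q)"]
    by (simp add: norm_eq plus_quat_def)
  show "norm (a *\<^sub>R p) = \<bar>a\<bar> * norm p"
    using norm_scaleR[of a "(qRe p, qIm1 p, qIm2 p, qIm3 p)"]
    by (simp add: norm_eq scaleR_quat_def)
  show "norm (p * q) = norm p * norm q"
    unfolding norm_quat_def real_sqrt_mult[symmetric]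
    by (rule arg_cong[where f = sqrt])
      (simp add: times_quat_def power2_eq_square algebra_simps)
qed

end

definition qconj :: "quat \<Rightarrow> quat"
  where "qconj q = Quat (qRe q) (- qIm1 q) (- qIm2 q) (- qIm3 q)"

lemma of_real_quat: "of_real r = Quat r 0 0 0"
  by (simp add: of_real_def scaleR_quat_def one_quat_def)

text \<open>
  The real scalar product is the real part of the quaternionic inner product. The norm, metric and
  topology inherited from \<^class>\<open>real_inner\<close> are therefore those of \<open>\<parallel>f\<parallel> = sqrt \<langle>f,f\<rangle>\<close>
  (see \<open>qinner_self\<close> and \<open>norm_eq_sqrt_qinner\<close>), and \<open>\<langle>f,f\<rangle> \<ge> 0\<close> with equality only for \<open>f = 0\<close>
  follows from positive definiteness in \<^class>\<open>real_inner\<close>.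
\<close>

class right_quat_inner = real_inner +
  fixes scaleQ :: "'a \<Rightarrow> quat \<Rightarrow> 'a"  (infixl \<open>\<cdot>\<^sub>q\<close> 75)
    and qinner :: "'a \<Rightarrow> 'a \<Rightarrow> quat"
  assumes scaleQ_add_left: "(x + y) \<cdot>\<^sub>q p = x \<cdot>\<^sub>q p + y \<cdot>\<^sub>q p"
    and scaleQ_add_right: "x \<cdot>\<^sub>q (p + q) = x \<cdot>\<^sub>q p + x \<cdot>\<^sub>q q"
    and scaleQ_scaleQ: "(x \<cdot>\<^sub>q p) \<cdot>\<^sub>q q = x \<cdot>\<^sub>q (p * q)"
    and scaleQ_one: "x \<cdot>\<^sub>q 1 = x"
    and scaleQ_of_real: "x \<cdot>\<^sub>q (of_real r) = r *\<^sub>R x"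
    and qinner_linear: "qinner x (y \<cdot>\<^sub>q q + z) = qinner x y * q + qinner x z"
    and qinner_conj: "qinner x y = qconj (qinner y x)"
    and inner_eq_qRe: "inner x y = qRe (qinner x y)"

class right_quat_hilbert = right_quat_inner + complete_space

lemma qinner_self: "qinner x x = of_real ((norm x)\<^sup>2)"
  for x :: "'a::right_quat_inner"
proof -
  have "qRe (qinner x x) = (norm x)\<^sup>2"
    by (metis inner_eq_qRe power2_norm_eq_inner)
  then show ?thesis
    using qinner_conj[of x x] by (simp add: of_real_quat quat_eq_iff qconj_def)
qed

lemma qinner_eq_zero_iff: "qinner x x = 0 \<longleftrightarrow> x = 0"
  for x :: "'a::right_quat_inner"
  by (simp add: qinner_self)

lemma norm_eq_sqrt_qinner: "norm x = sqrt (qRe (qinner x x))"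
  for x :: "'a::right_quat_inner"
  by (simp add: norm_eq_sqrt_inner inner_eq_qRe)

definition finite_qdim :: "'a::right_quat_inner set \<Rightarrow> bool"
  where "finite_qdim W \<longleftrightarrow>
    (\<exists>B. finite B \<and> B \<subseteq> W \<and> (\<forall>x\<in>W. \<exists>c. x = (\<Sum>b\<in>B. b \<cdot>\<^sub>q c b)))"

text \<open>
  The sets below are meant for a closed right-linear subspace \<open>W\<close> of the ambient space (the whole
  space being \<^term>\<open>UNIV\<close>), which is a right quaternionic Hilbert space in its own right. An operator
  on \<open>W\<close> is given by a function on the ambient type of which only the values on \<open>W\<close> matter.
\<close>

definition bounded_ops :: "'a::right_quat_inner set \<Rightarrow> ('a \<Rightarrow> 'a) set"
  where "bounded_ops W = {T.
    (\<forall>x\<in>W. T x \<in> W) \<and>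
    (\<forall>x\<in>W. \<forall>y\<in>W. T (x + y) = T x + T y) \<and>
    (\<forall>x\<in>W. \<forall>q. T (x \<cdot>\<^sub>q q) = T x \<cdot>\<^sub>q q) \<and>
    (\<exists>K. \<forall>x\<in>W. norm (T x) \<le> K * norm x)}"

text \<open>As \<open>W\<close> is closed, the closure below is the closure in \<open>W\<close>.\<close>

definition compact_ops :: "'a::right_quat_inner set \<Rightarrow> ('a \<Rightarrow> 'a) set"
  where "compact_ops W =
    {T \<in> bounded_ops W. \<forall>A\<subseteq>W. bounded A \<longrightarrow> compact (closure (T ` A))}"

definition Q_op :: "quat \<Rightarrow> ('a \<Rightarrow> 'a) \<Rightarrow> 'a \<Rightarrow> 'a::right_quat_inner"
  where "Q_op q B = (\<lambda>x. B (B x) - (2 * qRe q) *\<^sub>R B x + (norm q)\<^sup>2 *\<^sub>R x)"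

definition ess_S_spectrum :: "'a::right_quat_inner set \<Rightarrow> ('a \<Rightarrow> 'a) \<Rightarrow> quat set"
  where "ess_S_spectrum W B = {q. \<not> (\<exists>S\<in>bounded_ops W.
    (\<lambda>x. S (Q_op q B x) - x) \<in> compact_ops W \<and>
    (\<lambda>x. Q_op q B (S x) - x) \<in> compact_ops W)}"

lemma range_projector:
  fixes P :: "'a \<Rightarrow> 'a::right_quat_inner"
  assumes P: "P \<in> bounded_ops UNIV" and idem: "P \<circ> P = P"
  shows "closed (range P)"
    and "0 \<in> range P"
    and "x \<in> range P \<Longrightarrow> y \<in> range P \<Longrightarrow> x + y \<in> range P"
    and "x \<in> range P \<Longrightarrow> x \<cdot>\<^sub>q q \<in> range P"
proof -
  from P obtain K where add: "\<And>x y. P (x + y) = P x + P y"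
    and scale: "\<And>x q. P (x \<cdot>\<^sub>q q) = P x \<cdot>\<^sub>q q" and K: "\<And>x. norm (P x) \<le> K * norm x"
    unfolding bounded_ops_def by auto
  have "P (r *\<^sub>R x) = r *\<^sub>R P x" for r x
    by (metis scale scaleQ_of_real)
  then have bl: "bounded_linear P"
    using add K by (intro bounded_linear_intro[of P K]) (auto simp: mult.commute)
  have "range P = {x. P x = x}"
  proof (intro equalityI subsetI CollectI)
    fix x assume "x \<in> range P"
    then show "P x = x" using fun_cong[OF idem] by auto
  next
    fix x assume "x \<in> {x. P x = x}"
    then have "x = P x" by simp
    then show "x \<in> range P" by (rule range_eqI)
  qed
  moreover have "closed {x. P x = x}"
    by (intro closed_Collect_eq continuous_intros linear_continuous_on bl)
  ultimately show "closed (range P)" by simp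
  show "0 \<in> range P" using linear_simps(3)[OF bl] by (intro range_eqI[of _ _ 0]) simp
  show "x + y \<in> range P" if "x \<in> range P" "y \<in> range P"
    using that by (auto simp flip: add)
  show "x \<cdot>\<^sub>q q \<in> range P" if "x \<in> range P"
    using that by (auto simp flip: scale)
qed

end

theory Submission
  imports Defs
begin

text \<open>
  The decomposition \<open>V = R(P\<^sub>1) \<oplus> R(P\<^sub>2)\<close> reduces \<open>T\<close>, hence also \<open>Q\<^sub>q(T)\<close>. Modulo compact operators, an
  inverse of \<open>Q\<^sub>q(T)\<close> compresses to inverses of its two parts, and conversely inverses \<open>S\<^sub>1\<close>, \<open>S\<^sub>2\<close>
  of the parts assemble to the inverse \<open>S\<^sub>1 P\<^sub>1 + S\<^sub>2 P\<^sub>2\<close> of \<open>Q\<^sub>q(T)\<close>.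
\<close>

section \<open>Bounded and compact operators on a subspace\<close>

lemma bounded_opsE:
  assumes "T \<in> bounded_ops W"
  obtains K where "K \<ge> 0" "\<And>x. x \<in> W \<Longrightarrow> norm (T x) \<le> K * norm x"
proof -
  obtain K where K: "\<forall>x\<in>W. norm (T x) \<le> K * norm x"
    using assms by (auto simp: bounded_ops_def)
  \<comment> \<open>The constant in \<open>bounded_ops\<close> may be negative when \<open>W\<close>
    is trivial; \<open>max K 0\<close> is still a bound and can be used as a monotone
    factor.\<close>
  have "norm (T x) \<le> max K 0 * norm x" if "x \<in> W" for x
    using K that by (meson max.cobounded1 mult_right_mono norm_ge_zero order_trans)
  then show thesis using that[of "max K 0"] by simp
qed

text \<open>Real scalars act as real quaternions, so right linearity contains real linearity. This
  opens the library of \<open>bounded_linear\<close> maps to operators on the whole space.\<close>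

lemma bounded_linear_bounded_ops:
  assumes "T \<in> bounded_ops UNIV"
  shows "bounded_linear T"
proof -
  from assms obtain K where K: "norm (T x) \<le> K * norm x" for x
    by (auto simp: bounded_ops_def)
  have scale: "T (x \<cdot>\<^sub>q q) = T x \<cdot>\<^sub>q q" and add: "T (x + y) = T x + T y" for x y q
    using assms by (auto simp: bounded_ops_def)
  have "T (r *\<^sub>R x) = r *\<^sub>R T x" for r x
    using scale[of x "of_real r"] by (simp only: scaleQ_of_real)
  with add K show ?thesis
    by (intro bounded_linear_intro[of T K]) (simp_all add: mult.commute)
qed

text \<open>Operators on \<open>W\<close> are functions on the ambient type, so agreement on
  \<open>W\<close> has to suffice. The closure assumptions keep \<open>x + y\<close> and
  \<open>x \<cdot>\<^sub>q q\<close> inside \<open>W\<close>, where \<open>S\<close> and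
  \<open>T\<close> can be exchanged.\<close>

lemma bounded_ops_cong:
  assumes "T \<in> bounded_ops W" "\<And>x. x \<in> W \<Longrightarrow> S x = T x"
    and "\<And>x y. x \<in> W \<Longrightarrow> y \<in> W \<Longrightarrow> x + y \<in> W" "\<And>x q. x \<in> W \<Longrightarrow> x \<cdot>\<^sub>q q \<in> W"
  shows "S \<in> bounded_ops W"
proof -
  have "\<exists>K. \<forall>x\<in>W. norm (S x) \<le> K * norm x"
    using assms(1,2) by (simp add: bounded_ops_def)
  then show ?thesis
    using assms(1) by (simp add: bounded_ops_def assms(2-4))
qed

lemma compact_ops_cong:
  assumes "T \<in> compact_ops W" "\<And>x. x \<in> W \<Longrightarrow> S x = T x"
    and "\<And>x y. x \<in> W \<Longrightarrow> y \<in> W \<Longrightarrow> x + y \<in> W" "\<And>x q. x \<in> W \<Longrightarrow> x \<cdot>\<^sub>q q \<in> W"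
  shows "S \<in> compact_ops W"
proof -
  have "S ` A = T ` A" if "A \<subseteq> W" for A
    using assms(2) that by (intro image_cong) auto
  moreover have "S \<in> bounded_ops W"
    using assms(1) by (intro bounded_ops_cong[OF _ assms(2-4)]) (simp_all add: compact_ops_def)
  ultimately show ?thesis
    using assms(1) by (simp add: compact_ops_def)
qed

lemma bounded_ops_subset:
  assumes "T \<in> bounded_ops U" "W \<subseteq> U" "T ` W \<subseteq> W"
  shows "T \<in> bounded_ops W"
proof -
  from assms(1) obtain K where "\<forall>x\<in>U. norm (T x) \<le> K * norm x"
    by (auto simp: bounded_ops_def)
  then have "\<exists>K. \<forall>x\<in>W. norm (T x) \<le> K * norm x" using assms(2) by blast
  with assms show ?thesis by (auto simp: bounded_ops_def subset_iff image_subset_iff)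
qed

lemma compact_ops_subset:
  assumes "T \<in> compact_ops U" "W \<subseteq> U" "T ` W \<subseteq> W"
  shows "T \<in> compact_ops W"
proof -
  have "T \<in> bounded_ops W"
    using assms by (intro bounded_ops_subset[of T U W]) (simp_all add: compact_ops_def)
  moreover have "compact (closure (T ` A))" if "A \<subseteq> W" "bounded A" for A
    using assms(1) subset_trans[OF that(1) assms(2)] that(2) by (simp add: compact_ops_def)
  ultimately show ?thesis by (simp add: compact_ops_def)
qed

text \<open>Two subspaces are allowed so that an operator living only on \<open>range P\<close> can
  be composed with \<open>P\<close> into an operator on the whole space.\<close>

lemma bounded_ops_comp:
  assumes S: "S \<in> bounded_ops W" and T: "T \<in> bounded_ops U" and sub: "T ` U \<subseteq> W" "W \<subseteq> U"
  shows "(\<lambda>x. S (T x)) \<in> bounded_ops U"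
proof -
  from S obtain K where K: "K \<ge> 0" "\<And>x. x \<in> W \<Longrightarrow> norm (S x) \<le> K * norm x"
    using bounded_opsE by blast
  from T obtain L where L: "\<And>x. x \<in> U \<Longrightarrow> norm (T x) \<le> L * norm x"
    using bounded_opsE by blast
  have "norm (S (T x)) \<le> (K * L) * norm x" if "x \<in> U" for x
  proof -
    have "norm (S (T x)) \<le> K * norm (T x)" using K(2) sub that by auto
    also have "\<dots> \<le> K * (L * norm x)" using K(1) L[OF that] by (rule mult_left_mono[rotated])
    finally show ?thesis by (simp add: mult.assoc)
  qed
  then have "\<exists>M. \<forall>x\<in>U. norm (S (T x)) \<le> M * norm x" by blast
  with S T sub show ?thesis by (auto simp: bounded_ops_def image_subset_iff subset_iff)
qed

lemma bounded_ops_add: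
  assumes S: "S \<in> bounded_ops UNIV" and T: "T \<in> bounded_ops UNIV"
  shows "(\<lambda>x. S x + T x) \<in> bounded_ops UNIV"
proof -
  obtain K where "\<And>x. norm (S x + T x) \<le> norm x * K"
    using bounded_linear.bounded
      [OF bounded_linear_add[OF S[THEN bounded_linear_bounded_ops] T[THEN bounded_linear_bounded_ops]]]
    by blast
  then have "\<exists>K. \<forall>x. norm (S x + T x) \<le> K * norm x" by (auto simp: mult.commute)
  with S T show ?thesis by (auto simp: bounded_ops_def scaleQ_add_left)
qed

text \<open>The inner operator carries bounded sets to bounded sets, on whose images under
  \<open>S\<close> compactness is already known.\<close>

lemma compact_ops_comp_right:
  assumes S: "S \<in> compact_ops W" and T: "T \<in> bounded_ops U" and sub: "T ` U \<subseteq> W" "W \<subseteq> U"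
  shows "(\<lambda>x. S (T x)) \<in> compact_ops U"
proof -
  have "compact (closure ((\<lambda>x. S (T x)) ` A))" if A: "A \<subseteq> U" "bounded A" for A
  proof -
    from T obtain K where K: "K \<ge> 0" "\<And>x. x \<in> U \<Longrightarrow> norm (T x) \<le> K * norm x"
      using bounded_opsE by blast
    from A(2) obtain M where M: "\<And>x. x \<in> A \<Longrightarrow> norm x \<le> M" by (auto simp: bounded_iff)
    have "norm (T x) \<le> K * M" if "x \<in> A" for x
      using K(2)[of x] mult_left_mono[OF M[OF that] K(1)] A(1) that by force
    then have "bounded (T ` A)" by (auto simp: bounded_iff)
    moreover have "T ` A \<subseteq> W" using A sub by auto
    ultimately have "compact (closure (S ` T ` A))" using S by (simp add: compact_ops_def)
    then show ?thesis by (simp add: image_image)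
  qed
  with S bounded_ops_comp[OF _ T sub] show ?thesis by (simp add: compact_ops_def)
qed

lemma compact_closure_subset:
  fixes K :: "'a::t2_space set"
  assumes "compact K" "A \<subseteq> K"
  shows "compact (closure A)"
proof -
  have "closure A \<subseteq> K" using assms by (intro closure_minimal compact_imp_closed)
  then have "K \<inter> closure A = closure A" by (rule Int_absorb1)
  then show ?thesis using compact_Int_closed[OF assms(1) closed_closure, of A] by simp
qed

text \<open>A continuous image of a compact set is compact, and \<open>S\<close> closure (T
  \<open>A)\<close> contains the image of \<open>A\<close>.\<close>

lemma compact_ops_comp_left:
  assumes S: "S \<in> bounded_ops UNIV" and T: "T \<in> compact_ops UNIV"
  shows "(\<lambda>x. S (T x)) \<in> compact_ops UNIV"
proof -
  have "compact (closure ((\<lambda>x. S (T x)) ` A))" if "bounded A" for A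
  proof -
    have "compact (closure (T ` A))" using T that by (simp add: compact_ops_def)
    then have c: "compact (S ` closure (T ` A))"
      by (rule compact_continuous_image[rotated])
        (rule linear_continuous_on[OF bounded_linear_bounded_ops[OF S]])
    have "(\<lambda>x. S (T x)) ` A \<subseteq> S ` closure (T ` A)" using closure_subset[of "T ` A"] by auto
    with c show ?thesis by (rule compact_closure_subset)
  qed
  moreover have "(\<lambda>x. S (T x)) \<in> bounded_ops UNIV"
    using T by (intro bounded_ops_comp[OF S]) (auto simp: compact_ops_def)
  ultimately show ?thesis by (simp add: compact_ops_def)
qed

lemma compact_ops_add:
  assumes S: "S \<in> compact_ops UNIV" and T: "T \<in> compact_ops UNIV"
  shows "(\<lambda>x. S x + T x) \<in> compact_ops UNIV"
proof -
  have "compact (closure ((\<lambda>x. S x + T x) ` A))" if "bounded A" for A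
  proof -
    \<comment> \<open>The sum of two compact sets is compact and contains all values
      \<open>S x + T x\<close> with \<open>x\<close> in \<open>A\<close>.\<close>
    let ?K = "{x + y | x y. x \<in> closure (S ` A) \<and> y \<in> closure (T ` A)}"
    have c: "compact ?K"
      using S T that by (intro compact_sums) (simp_all add: compact_ops_def)
    have "(\<lambda>x. S x + T x) ` A \<subseteq> ?K"
      using closure_subset[of "S ` A"] closure_subset[of "T ` A"] by blast
    with c show ?thesis by (rule compact_closure_subset)
  qed
  with S T bounded_ops_add[of S T] show ?thesis by (simp add: compact_ops_def)
qed

text \<open>An inverse modulo compact operators: \<open>S\<close> represents an inverse of the class
  of \<open>Q\<close> in the Calkin algebra over \<open>W\<close>.\<close>

definition parametrix :: "'v::right_quat_inner set \<Rightarrow> ('v \<Rightarrow> 'v) \<Rightarrow> ('v \<Rightarrow> 'v) \<Rightarrow> bool"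
  where "parametrix W Q S \<longleftrightarrow> S \<in> bounded_ops W \<and>
    (\<lambda>x. S (Q x) - x) \<in> compact_ops W \<and> (\<lambda>x. Q (S x) - x) \<in> compact_ops W"

lemma ess_S_spectrum_iff: "q \<in> ess_S_spectrum W B \<longleftrightarrow> \<not> (\<exists>S. parametrix W (Q_op q B) S)"
  by (simp only: ess_S_spectrum_def parametrix_def mem_Collect_eq Bex_def)

section \<open>Reduction by a projector commuting with the operator\<close>

locale reducing_projector =
  fixes T P :: "'v::right_quat_inner \<Rightarrow> 'v"
  assumes T: "T \<in> bounded_ops UNIV"
    and P: "P \<in> bounded_ops UNIV"
    and idem: "P (P x) = P x"
    and commute: "T (P x) = P (T x)"
begin

lemma range_add: "x \<in> range P \<Longrightarrow> y \<in> range P \<Longrightarrow> x + y \<in> range P"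
  and range_scaleQ: "x \<in> range P \<Longrightarrow> x \<cdot>\<^sub>q q \<in> range P"
proof -
  have PP: "P \<circ> P = P" by (rule ext) (simp add: idem)
  show "x \<in> range P \<Longrightarrow> y \<in> range P \<Longrightarrow> x + y \<in> range P"
    by (rule range_projector(3)[OF P PP])
  show "x \<in> range P \<Longrightarrow> x \<cdot>\<^sub>q q \<in> range P"
    by (rule range_projector(4)[OF P PP])
qed

lemma proj_eq: "x \<in> range P \<Longrightarrow> P x = x"
  by (auto simp: idem)

lemma Q_op_commute: "Q_op q T (P x) = P (Q_op q T x)"
  using linear_simps[OF bounded_linear_bounded_ops[OF P]] by (simp add: Q_op_def commute)

text \<open>Since \<open>T\<close> commutes with \<open>P\<close>, it maps \<open>range P\<close>
  into itself. Both applications of the restricted operator inside \<open>Q_op\<close> therefore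
  meet arguments in \<open>range P\<close>, never the undefined values outside.\<close>

lemma Q_op_restrict:
  assumes "x \<in> range P"
  shows "Q_op q (restrict (T \<circ> P) (range P)) x = Q_op q T x"
proof -
  have x: "P x = x" using assms by (rule proj_eq)
  have Tx: "P (T x) = T x" using commute[of x] by (simp only: x)
  then have "T x \<in> range P" by (rule range_eqI[OF sym])
  with assms show ?thesis by (simp only: Q_op_def restrict_apply o_apply x Tx if_True)
qed

text \<open>Applying \<open>P\<close> to both compact defects of \<open>S\<close> leaves them
  compact, and on \<open>range P\<close> the results are exactly the defects of the compression of
  \<open>S\<close>.\<close>

lemma compress_parametrix:
  assumes "parametrix UNIV (Q_op q T) S"
  shows "parametrix (range P) (Q_op q (restrict (T \<circ> P) (range P))) (\<lambda>x. P (S x))"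
proof -
  from assms have S: "S \<in> bounded_ops UNIV"
    and l: "(\<lambda>x. S (Q_op q T x) - x) \<in> compact_ops UNIV"
    and r: "(\<lambda>x. Q_op q T (S x) - x) \<in> compact_ops UNIV"
    by (simp_all only: parametrix_def)
  note P_lin = linear_simps[OF bounded_linear_bounded_ops[OF P]]
  let ?Q = "Q_op q (restrict (T \<circ> P) (range P))"
  have bd: "(\<lambda>x. P (S x)) \<in> bounded_ops (range P)"
    using bounded_ops_subset[OF bounded_ops_comp[OF P S], of "range P"] by auto
  have "(\<lambda>x. P (S (Q_op q T x) - x)) \<in> compact_ops (range P)"
    by (rule compact_ops_subset[OF compact_ops_comp_left[OF P l]]) auto
  then have l': "(\<lambda>x. P (S (?Q x)) - x) \<in> compact_ops (range P)"
    by (rule compact_ops_cong[OF _ _ range_add range_scaleQ]) (simp only: Q_op_restrict P_lin proj_eq)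
  have "(\<lambda>x. P (Q_op q T (S x) - x)) \<in> compact_ops (range P)"
    by (rule compact_ops_subset[OF compact_ops_comp_left[OF P r]]) auto
  \<comment> \<open>Here \<open>P\<close> is moved past \<open>Q_op q T\<close>, so that it acts on
    \<open>S x\<close> first.\<close>
  then have r': "(\<lambda>x. ?Q (P (S x)) - x) \<in> compact_ops (range P)"
    by (rule compact_ops_cong[OF _ _ range_add range_scaleQ])
      (simp only: Q_op_restrict[OF rangeI] P_lin proj_eq Q_op_commute)
  from bd l' r' show ?thesis by (simp only: parametrix_def)
qed

text \<open>Precomposing with \<open>P\<close> extends \<open>S\<close> and its compact defects to
  the whole space. The identity of \<open>range P\<close> turns into \<open>P\<close>, hence
  \<open>P x\<close> is subtracted instead of \<open>x\<close>.\<close>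

lemma extend_parametrix:
  assumes "parametrix (range P) (Q_op q (restrict (T \<circ> P) (range P))) S"
  shows "(\<lambda>x. S (P x)) \<in> bounded_ops UNIV"
    and "(\<lambda>x. S (P (Q_op q T x)) - P x) \<in> compact_ops UNIV"
    and "(\<lambda>x. Q_op q T (S (P x)) - P x) \<in> compact_ops UNIV"
proof -
  let ?Q = "Q_op q (restrict (T \<circ> P) (range P))"
  from assms have S: "S \<in> bounded_ops (range P)"
    and l: "(\<lambda>x. S (?Q x) - x) \<in> compact_ops (range P)"
    and r: "(\<lambda>x. ?Q (S x) - x) \<in> compact_ops (range P)"
    by (simp_all only: parametrix_def)
  have S_mem: "S (P x) \<in> range P" for x using S by (auto simp: bounded_ops_def)
  show "(\<lambda>x. S (P x)) \<in> bounded_ops UNIV"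
    by (rule bounded_ops_comp[OF S P]) auto
  have "(\<lambda>x. S (?Q (P x)) - P x) \<in> compact_ops UNIV"
    by (rule compact_ops_comp_right[OF l P]) auto
  then show "(\<lambda>x. S (P (Q_op q T x)) - P x) \<in> compact_ops UNIV"
    by (simp only: Q_op_restrict[OF rangeI] Q_op_commute)
  have "(\<lambda>x. ?Q (S (P x)) - P x) \<in> compact_ops UNIV"
    by (rule compact_ops_comp_right[OF r P]) auto
  then show "(\<lambda>x. Q_op q T (S (P x)) - P x) \<in> compact_ops UNIV"
    by (simp only: Q_op_restrict[OF S_mem])
qed

text \<open>This makes every result of the locale available for the complementary projector as
  well.\<close>

lemma reducing_projector_compl: "reducing_projector T (\<lambda>x. x - P x)"
proof
  note T_lin = linear_simps[OF bounded_linear_bounded_ops[OF T]]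
  note P_lin = linear_simps[OF bounded_linear_bounded_ops[OF P]]
  have "(\<lambda>x::'v. x) \<in> bounded_ops UNIV"
  proof -
    have "\<exists>K. \<forall>x::'v. norm x \<le> K * norm x" by (rule exI[of _ 1]) simp
    then show ?thesis by (simp add: bounded_ops_def)
  qed
  moreover have "(\<lambda>x. - P x) \<in> bounded_ops UNIV"
  proof -
    \<comment> \<open>Additivity yields \<open>0 \<cdot>\<^sub>q q = 0\<close>, hence
      \<open>(- x) \<cdot>\<^sub>q q\<close> and \<open>x \<cdot>\<^sub>q q\<close> cancel.\<close>
    have "(- x) \<cdot>\<^sub>q q = - (x \<cdot>\<^sub>q q)" for x :: 'v and q
      using scaleQ_add_left[of "- x" x q] scaleQ_add_left[of 0 0 q]
      by (metis add_cancel_left_left left_minus minus_unique add.commute)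
    with P show ?thesis by (auto simp: bounded_ops_def)
  qed
  ultimately show "(\<lambda>x. x - P x) \<in> bounded_ops UNIV"
    using bounded_ops_add[of "\<lambda>x. x" "\<lambda>x. - P x"] by simp
  show "T \<in> bounded_ops UNIV" by (rule T)
  fix x
  show "x - P x - P (x - P x) = x - P x" by (simp add: P_lin idem)
  show "T (x - P x) = T x - P (T x)" by (simp add: T_lin commute)
qed

end

theorem theorem3p4:
  fixes T P1 P2 T1 T2 :: "'v::right_quat_hilbert \<Rightarrow> 'v"
  assumes separable: "\<exists>D::'v set. countable D \<and> closure D = UNIV"
    and infinite_dim: "\<not> finite_qdim (UNIV :: 'v set)"
    and T: "T \<in> bounded_ops UNIV"
    and P1: "P1 \<in> bounded_ops UNIV"
    and projector: "P1 \<circ> P1 = P1"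
    and commute: "T \<circ> P1 = P1 \<circ> T"
    and P2: "P2 = (\<lambda>x. x - P1 x)"
    and T1: "T1 = T \<circ> P1"
    and T2: "T2 = T \<circ> P2"
  shows "ess_S_spectrum UNIV T =
    ess_S_spectrum (range P1) (restrict T1 (range P1)) \<union>
    ess_S_spectrum (range P2) (restrict T2 (range P2))"
proof -
  interpret R1: reducing_projector T P1
  proof
    show "T \<in> bounded_ops UNIV" "P1 \<in> bounded_ops UNIV" by fact+
    show "P1 (P1 x) = P1 x" "T (P1 x) = P1 (T x)" for x
      using fun_cong[OF projector] fun_cong[OF commute] by simp_all
  qed
  interpret R2: reducing_projector T P2
    unfolding P2 by (rule R1.reducing_projector_compl)
  note T_lin = linear_simps[OF bounded_linear_bounded_ops[OF T]]
  have "(\<exists>S. parametrix UNIV (Q_op q T) S) \<longleftrightarrow>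
    (\<exists>S1. parametrix (range P1) (Q_op q (restrict T1 (range P1))) S1) \<and>
    (\<exists>S2. parametrix (range P2) (Q_op q (restrict T2 (range P2))) S2)"
    (is "?l \<longleftrightarrow> ?r1 \<and> ?r2") for q
  proof (intro iffI)
    assume ?l
    then obtain S where "parametrix UNIV (Q_op q T) S" ..
    from R1.compress_parametrix[OF this] R2.compress_parametrix[OF this]
    show "?r1 \<and> ?r2" unfolding T1 T2 by (intro conjI exI)
  next
    assume "?r1 \<and> ?r2"
    then obtain S1 S2 where
      S1: "parametrix (range P1) (Q_op q (restrict (T \<circ> P1) (range P1))) S1" and
      S2: "parametrix (range P2) (Q_op q (restrict (T \<circ> P2) (range P2))) S2"
      unfolding T1 T2 by (elim conjE exE)
    note e1 = R1.extend_parametrix[OF S1] and e2 = R2.extend_parametrix[OF S2]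
    let ?S = "\<lambda>x. S1 (P1 x) + S2 (P2 x)"
    have P12: "P1 x + P2 x = x" for x by (simp add: P2)
    have Q_add: "Q_op q T (x + y) = Q_op q T x + Q_op q T y" for x y
      by (simp add: Q_op_def T_lin algebra_simps)
    \<comment> \<open>Splitting \<open>x\<close> as \<open>P1 x + P2 x\<close> writes the defect of
      \<open>?S\<close> as the sum of the two extended compact defects.\<close>
    have "?S (Q_op q T x) - x =
        (S1 (P1 (Q_op q T x)) - P1 x) + (S2 (P2 (Q_op q T x)) - P2 x)" for x
      using P12[of x] by (simp add: algebra_simps)
    then have l: "(\<lambda>x. ?S (Q_op q T x) - x) \<in> compact_ops UNIV"
      using compact_ops_add[OF e1(2) e2(2)] by (simp only:)
    have "Q_op q T (?S x) - x =
        (Q_op q T (S1 (P1 x)) - P1 x) + (Q_op q T (S2 (P2 x)) - P2 x)" for x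
      using P12[of x] by (simp add: Q_add algebra_simps)
    then have r: "(\<lambda>x. Q_op q T (?S x) - x) \<in> compact_ops UNIV"
      using compact_ops_add[OF e1(3) e2(3)] by (simp only:)
    have "parametrix UNIV (Q_op q T) ?S"
      using bounded_ops_add[OF e1(1) e2(1)] l r by (simp only: parametrix_def)
    then show ?l by (rule exI[of _ ?S])
  qed
  \<comment> \<open>The spectra are the sets of \<open>q\<close> without a parametrix, so negating
    the equivalence turns the conjunction into the union.\<close>
  then show ?thesis by (simp only: set_eq_iff Un_iff ess_S_spectrum_iff de_Morgan_conj) simp
qed

end
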